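(* Let $\mathcal{C}$ be a Cayley algebra over a field $\mathbb{F}$ of characteristic $2$. Then the Lie algebra of derivations $\mathrm{Der}(\mathcal{C})$ is isomorphic to the projective special linear Lie algebra $\mathfrak{psl}_4(\mathbb{F})$ (independently of the isomorphism class of $\mathcal{C}$).
   Context: A Cayley algebra over a field $\mathbb{F}$ is a unital nonassociative $\mathbb{F}$-algebra $\mathcal{C}$ of dimension $8$ endowed with a quadratic form $q:\mathcal{C}\to\mathbb{F}$ (the norm) that is multiplicative ($q(xy)=q(x)q(y)$) and nonsingular, i.e. the polar form $b_q(x,y)=q(x+y)-q(x)-q(y)$ is nondegenerate. $\mathrm{Der}(\mathcal{C})=\{d\in\mathfrak{gl}(\mathcal{C}): d(xy)=d(x)y+xd(y)\ \forall x,y\in\mathcal{C}\}$. In characteristic $2$, $\mathfrak{psl}_4(\mathbb{F})=\mathfrak{sl}_4(\mathbb{F})/\mathbb{F}I_4$. *)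

theory Defs
  imports "HOL-Analysis.Analysis"
begin

section \<open>Lie algebras with explicit carriers\<close>

record ('k, 'a) lie =
  lcarrier :: "'a set"
  ladd :: "'a \<Rightarrow> 'a \<Rightarrow> 'a"
  lscale :: "'k \<Rightarrow> 'a \<Rightarrow> 'a"
  lbracket :: "'a \<Rightarrow> 'a \<Rightarrow> 'a"

definition lie_iso :: "('k, 'a) lie \<Rightarrow> ('k, 'b) lie \<Rightarrow> ('a \<Rightarrow> 'b) set" where
  "lie_iso L M = {f. bij_betw f (lcarrier L) (lcarrier M) \<and>
     (\<forall>x\<in>lcarrier L. \<forall>y\<in>lcarrier L. f (ladd L x y) = ladd M (f x) (f y)) \<and>
     (\<forall>c. \<forall>x\<in>lcarrier L. f (lscale L c x) = lscale M c (f x)) \<and>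
     (\<forall>x\<in>lcarrier L. \<forall>y\<in>lcarrier L. f (lbracket L x y) = lbracket M (f x) (f y))}"

definition lie_isomorphic :: "('k, 'a) lie \<Rightarrow> ('k, 'b) lie \<Rightarrow> bool" where
  "lie_isomorphic L M \<longleftrightarrow> lie_iso L M \<noteq> {}"

definition lie_coset :: "('k, 'a) lie \<Rightarrow> 'a set \<Rightarrow> 'a \<Rightarrow> 'a set" where
  "lie_coset L I x = ladd L x ` I"

text \<open>
  The operations of the quotient by an ideal \<open>I\<close>, written without choosing representatives:
  when \<open>I\<close> is an ideal, all members of the unions below are the same coset (this is proved
  for the only instance needed in \<open>psl4_ops\<close> below).
\<close>

definition lie_quotient :: "('k, 'a) lie \<Rightarrow> 'a set \<Rightarrow> ('k, 'a set) lie" where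
  "lie_quotient L I =
     \<lparr>lcarrier = lie_coset L I ` lcarrier L,
      ladd = (\<lambda>X Y. \<Union>x\<in>X. \<Union>y\<in>Y. lie_coset L I (ladd L x y)),
      lscale = (\<lambda>c X. \<Union>x\<in>X. lie_coset L I (lscale L c x)),
      lbracket = (\<lambda>X Y. \<Union>x\<in>X. \<Union>y\<in>Y. lie_coset L I (lbracket L x y))\<rparr>"


section \<open>The Lie algebras $\mathfrak{sl}_n$ and $\mathfrak{psl}_4$\<close>

abbreviation mat_scale :: "'k::times \<Rightarrow> 'k^'n^'m \<Rightarrow> 'k^'n^'m" where
  "mat_scale c \<equiv> map_matrix ((*) c)"

definition sl :: "('k::field, 'k^'n^'n) lie" where
  "sl = \<lparr>lcarrier = {A. trace A = 0}, ladd = (+), lscale = mat_scale,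
         lbracket = (\<lambda>A B. A ** B - B ** A)\<rparr>"

definition scalar_matrices :: "('k::field^'n^'n) set" where
  "scalar_matrices = range mat"

text \<open>
  This is $\mathfrak{psl}_4$ only in characteristic 2: there the scalar matrices of size 4 have
  trace 0 and hence form an ideal of $\mathfrak{sl}_4$.
\<close>

definition psl4 :: "('k::field, ('k^4^4) set) lie" where
  "psl4 = lie_quotient sl scalar_matrices"

lemma scalar_matrices_subset_sl:
  assumes "CHAR('k::field) = 2"
  shows "(scalar_matrices :: ('k^4^4) set) \<subseteq> lcarrier sl"
proof -
  have "(2::'k) = 0" using of_nat_CHAR[where 'a='k] assms by simp
  hence "(4::'k) = 0" by (metis mult_2 add_0 numeral_Bit0)
  thus ?thesis
    by (auto simp: scalar_matrices_def sl_def trace_def mat_def)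
qed

lemma scalar_matrices_0 [simp]: "0 \<in> scalar_matrices"
  unfolding scalar_matrices_def by (rule range_eqI[of _ _ 0]) (simp add: mat_def vec_eq_iff)

lemma scalar_matrices_add:
  assumes "S \<in> scalar_matrices" "T \<in> scalar_matrices"
  shows "S + T \<in> scalar_matrices"
proof -
  have "mat a + mat b = (mat (a + b) :: 'a^'b^'b)" for a b
    by (simp add: mat_def vec_eq_iff)
  thus ?thesis using assms unfolding scalar_matrices_def by auto
qed

lemma scalar_matrices_scale:
  assumes "S \<in> scalar_matrices"
  shows "mat_scale c S \<in> scalar_matrices"
proof -
  have "mat_scale c (mat a) = (mat (c * a) :: 'a^'b^'b)" for a
    by (simp add: mat_def vec_eq_iff)
  thus ?thesis using assms unfolding scalar_matrices_def by auto
qed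

lemma scalar_matrices_uminus:
  assumes "S \<in> scalar_matrices"
  shows "- S \<in> scalar_matrices"
proof -
  have "- S = mat_scale (-1) S" by (simp add: vec_eq_iff)
  thus ?thesis using assms scalar_matrices_scale by metis
qed

lemma scalar_matrices_commute: "S \<in> scalar_matrices \<Longrightarrow> S ** A = A ** S"
  by (auto simp: scalar_matrices_def mat_def matrix_matrix_mult_def vec_eq_iff
      if_distrib if_distribR mult.commute cong: if_cong)

lemma mem_coset_sl: "B \<in> lie_coset sl scalar_matrices A \<longleftrightarrow> B - A \<in> scalar_matrices"
  by (force simp: lie_coset_def sl_def image_iff algebra_simps)

lemma coset_sl_eq_iff:
  "lie_coset sl scalar_matrices A = lie_coset sl scalar_matrices B \<longleftrightarrow> A - B \<in> scalar_matrices"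
proof
  assume "lie_coset sl scalar_matrices A = lie_coset sl scalar_matrices B"
  thus "A - B \<in> scalar_matrices"
    by (metis mem_coset_sl diff_self scalar_matrices_0)
next
  assume *: "A - B \<in> scalar_matrices"
  have "X - A \<in> scalar_matrices \<longleftrightarrow> X - B \<in> scalar_matrices" for X
    using scalar_matrices_add[OF _ *, of "X - A"]
      scalar_matrices_add[OF _ scalar_matrices_uminus[OF *], of "X - B"] by auto
  thus "lie_coset sl scalar_matrices A = lie_coset sl scalar_matrices B"
    by (auto simp: mem_coset_sl)
qed

lemma psl4_ops:
  fixes A B :: "'k::field^4^4"
  defines "C \<equiv> lie_coset sl scalar_matrices"
  shows "ladd psl4 (C A) (C B) = C (A + B)"
    and "lscale psl4 c (C A) = C (mat_scale c A)"
    and "lbracket psl4 (C A) (C B) = C (A ** B - B ** A)"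
proof -
  have self: "A \<in> C A" for A by (simp add: C_def mem_coset_sl)
  have add: "C (X + Y) = C (A + B)" if "X \<in> C A" "Y \<in> C B" for X Y
    using scalar_matrices_add[of "X - A" "Y - B"] that
    by (auto simp: C_def mem_coset_sl coset_sl_eq_iff algebra_simps)
  have scale: "C (mat_scale c X) = C (mat_scale c A)" if "X \<in> C A" for X
  proof -
    have "mat_scale c X - mat_scale c A = mat_scale c (X - A)"
      by (simp add: vec_eq_iff right_diff_distrib)
    thus ?thesis using that scalar_matrices_scale[of "X - A" c]
      by (auto simp: C_def mem_coset_sl coset_sl_eq_iff)
  qed
  have br: "X ** Y - Y ** X = A ** B - B ** A" if "X \<in> C A" "Y \<in> C B" for X Y
  proof -
    define S T where "S = X - A" and "T = Y - B"
    have S: "S \<in> scalar_matrices" "X = A + S" and T: "T \<in> scalar_matrices" "Y = B + T"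
      using that by (auto simp: C_def mem_coset_sl S_def T_def)
    have rdistrib: "(P + Q) ** R = P ** R + Q ** R" for P Q R :: "'k^4^4"
      by (simp add: matrix_matrix_mult_def vec_eq_iff distrib_right sum.distrib)
    show ?thesis unfolding S(2) T(2)
      using scalar_matrices_commute[OF S(1), of B] scalar_matrices_commute[OF S(1), of T]
        scalar_matrices_commute[OF T(1), of A]
      by (simp add: matrix_add_ldistrib rdistrib)
  qed
  have "ladd psl4 (C A) (C B) = (\<Union>X\<in>C A. \<Union>Y\<in>C B. C (X + Y))"
    by (simp add: psl4_def lie_quotient_def C_def sl_def)
  thus "ladd psl4 (C A) (C B) = C (A + B)" using self add by blast
  have "lscale psl4 c (C A) = (\<Union>X\<in>C A. C (mat_scale c X))"
    by (simp add: psl4_def lie_quotient_def C_def sl_def)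
  thus "lscale psl4 c (C A) = C (mat_scale c A)" using self scale by blast
  have "lbracket psl4 (C A) (C B) = (\<Union>X\<in>C A. \<Union>Y\<in>C B. C (X ** Y - Y ** X))"
    by (simp add: psl4_def lie_quotient_def C_def sl_def)
  also have "\<dots> = (\<Union>X\<in>C A. \<Union>Y\<in>C B. C (A ** B - B ** A))"
    using br by simp
  also have "\<dots> = C (A ** B - B ** A)" using self by blast
  finally show "lbracket psl4 (C A) (C B) = C (A ** B - B ** A)" .
qed


section \<open>Cayley algebras and their derivations\<close>

definition polar :: "('c::ab_group_add \<Rightarrow> 'k::ab_group_add) \<Rightarrow> 'c \<Rightarrow> 'c \<Rightarrow> 'k" where
  "polar q x y = q (x + y) - q x - q y"

locale nonassoc_algebra = vector_space sc
  for sc :: "'k::field \<Rightarrow> 'c::ab_group_add \<Rightarrow> 'c" +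
  fixes mu :: "'c \<Rightarrow> 'c \<Rightarrow> 'c"
  assumes mult_linear_left: "\<And>y. Vector_Spaces.linear sc sc (\<lambda>x. mu x y)"
    and mult_linear_right: "\<And>x. Vector_Spaces.linear sc sc (mu x)"

locale quadratic_space = vector_space sc
  for sc :: "'k::field \<Rightarrow> 'c::ab_group_add \<Rightarrow> 'c" +
  fixes q :: "'c \<Rightarrow> 'k"
  assumes q_scale: "q (sc a x) = a\<^sup>2 * q x"
    and polar_linear_left: "\<And>y. Vector_Spaces.linear sc (*) (\<lambda>x. polar q x y)"
    and polar_linear_right: "\<And>x. Vector_Spaces.linear sc (*) (polar q x)"

locale cayley_algebra = nonassoc_algebra sc mu + quadratic_space sc q
  for sc :: "'k::field \<Rightarrow> 'c::ab_group_add \<Rightarrow> 'c"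
    and mu :: "'c \<Rightarrow> 'c \<Rightarrow> 'c"
    and q :: "'c \<Rightarrow> 'k" +
  assumes unital: "\<exists>e. \<forall>x. mu e x = x \<and> mu x e = x"
    and dim_8: "dim (UNIV :: 'c set) = 8"
    and q_mult: "q (mu x y) = q x * q y"
    and nonsingular: "(\<forall>y. polar q x y = 0) \<Longrightarrow> x = 0"

definition Der :: "('k::field \<Rightarrow> 'c::ab_group_add \<Rightarrow> 'c) \<Rightarrow> ('c \<Rightarrow> 'c \<Rightarrow> 'c) \<Rightarrow> ('k, 'c \<Rightarrow> 'c) lie" where
  "Der sc mu =
     \<lparr>lcarrier = {d. Vector_Spaces.linear sc sc d \<and>
                     (\<forall>x y. d (mu x y) = mu (d x) y + mu x (d y))},
      ladd = (\<lambda>d e x. d x + e x),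
      lscale = (\<lambda>a d x. sc a (d x)),
      lbracket = (\<lambda>d e x. d (e x) - e (d x))\<rparr>"

end

theory Submission
  imports Defs
begin

text \<open>
  Write $b$ for the polar form, $C_0 = 1^\perp$ and $W = C_0/\mathbb{F}1$. In characteristic 2 the
  form $b$ is alternating and $1 \in C_0$, so $W$ is a symplectic space of dimension 6. A derivation
  kills 1, maps into $C_0$ and is skew for $b$, hence it acts on $W$ as an element of the
  15-dimensional Lie algebra $\mathfrak{o}(W, b) \cong \Lambda^2 W$. The symplectic space
  $(W, b)$ is unique up to isometry and it is a copy of $\Lambda^2 \mathbb{F}^4$ with the form
  $b(p \wedge q, r \wedge s) = \det(p, q, r, s)$, on which $\mathfrak{sl}_4$ acts by
  $A \cdot (p \wedge q) = Ap \wedge q + p \wedge Aq$, the scalar matrices acting as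
  multiplication by $2a = 0$. It turns out that the derivations induce on $W$ exactly the
  operators coming from $\mathfrak{sl}_4$, a subspace of codimension 1 of $\mathfrak{o}(W, b)$, and this
  explains why the isomorphism class of the Cayley algebra is irrelevant.

  There are enough derivations: for $a, b \in C_0$ the commutator $[L_a, R_b]$ is a derivation
  (\<open>derivation_inner_der\<close>), because left and right multiplications obey the infinitesimal
  principle of triality and their commutators $[L_a, L_b]$, $[R_a, R_b]$ are the scalar $b(a,b)$.
  Modulo 1 it acts on $C_0$ by $c \mapsto b(a,b)c + b(a,c)b + b(b,c)a$ (\<open>inner_der_apply\<close>). In a
  symplectic basis, suitable combinations of these realise every matrix of trace 0
  (\<open>sl_der\<close>, \<open>induces_sl_der\<close>).

  There are no more derivations: in $\mathfrak{o}(W, b)$ the identity spans a complement of the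
  operators just realised. So up to some \<open>sl_der A\<close> any derivation is a scalar $s$ on $W$. A
  nonzero $s$ would produce a totally singular complement of $\mathbb{F}1$ in $C_0$, contradicting the
  nondegeneracy of $b$ on $W$ (\<open>derivation_mod_unit_scalar_zero\<close>), and a derivation that acts as 0 on
  $W$ vanishes (\<open>derivation_eq_zero\<close>). Hence \<open>sl_der\<close> maps the matrices of trace 0 onto the
  derivations, with the scalar matrices as kernel (\<open>sl_der_eq_zero_iff\<close>), and it preserves
  brackets since a derivation is determined by the operator it induces on $W$ (\<open>induces_unique\<close>).
\<close>

section \<open>Composition algebra identities in characteristic 2\<close>

locale cayley_char2 =
  cayley_algebra sc mu q
  for sc :: "'k::field \<Rightarrow> 'c::ab_group_add \<Rightarrow> 'c" (infixr "\<cdot>" 75)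
    and mu :: "'c \<Rightarrow> 'c \<Rightarrow> 'c" (infixl "\<odot>" 70)
    and q :: "'c \<Rightarrow> 'k" +
  fixes e :: 'c
  assumes char2: "CHAR('k) = 2"
    and unit_left [simp]: "e \<odot> x = x"
    and unit_right [simp]: "x \<odot> e = x"
begin

abbreviation bil :: "'c \<Rightarrow> 'c \<Rightarrow> 'k" ("\<langle>_,/ _\<rangle>") where
  "\<langle>x, y\<rangle> \<equiv> polar q x y"

text \<open>
  Signs disappear in characteristic 2. The next simplification rules turn every difference into a
  sum and cancel repeated summands, after which sorting the summands decides linear identities.
\<close>

lemma k_double [simp]: "a + a = (0::'k)"
proof -
  have "(2::'k) = 0" using of_nat_CHAR[where 'a='k] char2 by simp
  moreover have "a + a = 2 * a" by (rule mult_2 [symmetric])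
  ultimately show ?thesis by simp
qed

lemma k_double_left [simp]: "a + (a + b) = (b::'k)"
  by (simp flip: add.assoc)

lemma k_uminus [simp]: "- a = (a::'k)"
  by (rule minus_unique) simp

lemma k_diff [simp]: "a - b = a + (b::'k)"
  by (simp only: diff_conv_add_uminus k_uminus)

lemma c_double [simp]: "x + x = (0::'c)"
  using scale_left_distrib[of 1 1 x] by simp

lemma c_double_left [simp]: "x + (x + y) = (y::'c)"
  by (simp flip: add.assoc)

lemma c_uminus [simp]: "- x = (x::'c)"
  by (rule minus_unique) simp

lemma c_diff [simp]: "x - y = x + (y::'c)"
  by (simp only: diff_conv_add_uminus c_uminus)

lemma c_eq_iff: "x = y \<longleftrightarrow> x + y = (0::'c)"
  by (auto simp: add_eq_0_iff)

lemma mu_simps [simp]: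
  "(x + y) \<odot> z = x \<odot> z + y \<odot> z" "z \<odot> (x + y) = z \<odot> x + z \<odot> y"
  "(a \<cdot> x) \<odot> z = a \<cdot> (x \<odot> z)" "z \<odot> (a \<cdot> x) = a \<cdot> (z \<odot> x)"
  using mult_linear_left[of z] mult_linear_right[of z]
  by (simp_all add: Vector_Spaces.linear_iff)

lemma mu_zero [simp]: "0 \<odot> z = 0" "z \<odot> 0 = 0"
  using mu_simps(3)[of 0 0 z] mu_simps(4)[of z 0 0] by (simp_all del: mu_simps)

lemma bil_simps [simp]:
  "\<langle>x + y, z\<rangle> = \<langle>x, z\<rangle> + \<langle>y, z\<rangle>" "\<langle>z, x + y\<rangle> = \<langle>z, x\<rangle> + \<langle>z, y\<rangle>"
  "\<langle>a \<cdot> x, z\<rangle> = a * \<langle>x, z\<rangle>" "\<langle>z, a \<cdot> x\<rangle> = a * \<langle>z, x\<rangle>"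
  using polar_linear_left[of z] polar_linear_right[of z]
  by (simp_all add: Vector_Spaces.linear_iff)

lemma bil_zero [simp]: "\<langle>0, z\<rangle> = 0" "\<langle>z, 0\<rangle> = 0"
  using bil_simps(3)[of 0 0 z] bil_simps(4)[of z 0 0] by (simp_all del: bil_simps)

lemma bil_sym: "\<langle>x, y\<rangle> = \<langle>y, x\<rangle>"
  by (simp add: polar_def add_ac)

lemma q_add: "q (x + y) = q x + q y + \<langle>x, y\<rangle>"
  by (simp add: polar_def add_ac)

lemma q_zero [simp]: "q 0 = 0"
  using q_scale[of 0 0] by simp

lemma bil_self [simp]: "\<langle>x, x\<rangle> = 0"
  by (simp add: polar_def)

lemma eq_if_bil_eq: "(\<And>w. \<langle>x, w\<rangle> = \<langle>y, w\<rangle>) \<Longrightarrow> x = y"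
  using nonsingular[of "x + y"] by (simp add: c_eq_iff[of x y])

lemma bil_mult_left: "\<langle>x \<odot> y, x \<odot> z\<rangle> = q x * \<langle>y, z\<rangle>"
proof -
  have "q (x \<odot> y + x \<odot> z) = q x * q (y + z)"
    using q_mult[of x "y + z"] by simp
  thus ?thesis by (simp add: q_add q_mult distrib_left)
qed

lemma bil_mult_right: "\<langle>y \<odot> x, z \<odot> x\<rangle> = \<langle>y, z\<rangle> * q x"
proof -
  have "q (y \<odot> x + z \<odot> x) = q (y + z) * q x"
    using q_mult[of "y + z" x] by simp
  thus ?thesis by (simp add: q_add q_mult distrib_right)
qed

lemma bil_exchange: "\<langle>x \<odot> y, z \<odot> w\<rangle> + \<langle>x \<odot> w, z \<odot> y\<rangle> = \<langle>x, z\<rangle> * \<langle>y, w\<rangle>"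
  using bil_mult_left[of "x + z" y w]
  by (simp add: bil_mult_left q_add distrib_right bil_sym[of "z \<odot> y" "x \<odot> w"] add_ac)

lemma left_adjoint: "\<langle>x \<odot> y, w\<rangle> = \<langle>x, e\<rangle> * \<langle>y, w\<rangle> + \<langle>y, x \<odot> w\<rangle>"
proof -
  have *: "\<langle>x, e\<rangle> * \<langle>y, w\<rangle> = \<langle>x \<odot> y, w\<rangle> + \<langle>x \<odot> w, y\<rangle>"
    using bil_exchange[of x y e w] by simp
  show ?thesis unfolding * by (simp add: bil_sym[of "x \<odot> w" y] add.assoc)
qed

lemma right_adjoint: "\<langle>y \<odot> x, w\<rangle> = \<langle>x, e\<rangle> * \<langle>y, w\<rangle> + \<langle>y, w \<odot> x\<rangle>"
proof -
  have *: "\<langle>x, e\<rangle> * \<langle>y, w\<rangle> = \<langle>y \<odot> x, w\<rangle> + \<langle>y, w \<odot> x\<rangle>"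
    using bil_exchange[of y x w e] by (simp add: mult.commute)
  show ?thesis unfolding * by (simp add: add.assoc)
qed

text \<open>
  For $y = 1$ this is the quadratic equation $x^2 = b(x,1)x + q(x)1$; the general form is left
  alternativity. Both sides have the same $b$-product with every vector, by adjointness and
  multiplicativity of $q$.
\<close>

lemma left_quadratic: "x \<odot> (x \<odot> y) = \<langle>x, e\<rangle> \<cdot> (x \<odot> y) + q x \<cdot> y"
  by (rule eq_if_bil_eq, subst left_adjoint) (simp add: bil_mult_left)

lemma right_quadratic: "(y \<odot> x) \<odot> x = \<langle>x, e\<rangle> \<cdot> (y \<odot> x) + q x \<cdot> y"
  by (rule eq_if_bil_eq, subst right_adjoint) (simp add: bil_mult_right mult.commute)

lemma left_linearized:
  "x \<odot> (y \<odot> z) + y \<odot> (x \<odot> z) = \<langle>x, e\<rangle> \<cdot> (y \<odot> z) + \<langle>y, e\<rangle> \<cdot> (x \<odot> z) + \<langle>x, y\<rangle> \<cdot> z"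
proof -
  have "x \<odot> (y \<odot> z) + y \<odot> (x \<odot> z) = (x + y) \<odot> ((x + y) \<odot> z) + x \<odot> (x \<odot> z) + y \<odot> (y \<odot> z)"
    by (simp add: add_ac)
  also have "\<dots> = \<langle>x, e\<rangle> \<cdot> (y \<odot> z) + \<langle>y, e\<rangle> \<cdot> (x \<odot> z) + \<langle>x, y\<rangle> \<cdot> z"
    unfolding left_quadratic
    by (simp add: q_add scale_left_distrib scale_right_distrib add_ac)
  finally show ?thesis .
qed

lemma right_linearized:
  "(z \<odot> x) \<odot> y + (z \<odot> y) \<odot> x = \<langle>x, e\<rangle> \<cdot> (z \<odot> y) + \<langle>y, e\<rangle> \<cdot> (z \<odot> x) + \<langle>x, y\<rangle> \<cdot> z"
proof -
  have "(z \<odot> x) \<odot> y + (z \<odot> y) \<odot> x = (z \<odot> (x + y)) \<odot> (x + y) + (z \<odot> x) \<odot> x + (z \<odot> y) \<odot> y"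
    by (simp add: add_ac)
  also have "\<dots> = \<langle>x, e\<rangle> \<cdot> (z \<odot> y) + \<langle>y, e\<rangle> \<cdot> (z \<odot> x) + \<langle>x, y\<rangle> \<cdot> z"
    unfolding right_quadratic
    by (simp add: q_add scale_left_distrib scale_right_distrib add_ac)
  finally show ?thesis .
qed

lemma anticommute: "x \<odot> y + y \<odot> x = \<langle>x, e\<rangle> \<cdot> y + \<langle>y, e\<rangle> \<cdot> x + \<langle>x, y\<rangle> \<cdot> e"
  using left_linearized[of x y e] by simp

text \<open>
  The infinitesimal principle of triality: with $T_a = L_a + R_a$, the triples $(L_a, T_a, L_a)$ and
  $(R_a, R_a, T_a)$ satisfy Leibniz rules. These are the linearized alternative laws, rearranged.
\<close>

lemma left_mult_triality: "a \<odot> (x \<odot> y) = (a \<odot> x + x \<odot> a) \<odot> y + x \<odot> (a \<odot> y)"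
proof -
  have "a \<odot> (x \<odot> y) = (a \<odot> (x \<odot> y) + x \<odot> (a \<odot> y)) + x \<odot> (a \<odot> y)"
    by (simp add: add.assoc)
  thus ?thesis unfolding left_linearized anticommute by simp
qed

lemma right_mult_triality: "(x \<odot> y) \<odot> a = (x \<odot> a) \<odot> y + x \<odot> (a \<odot> y + y \<odot> a)"
proof -
  have "(x \<odot> y) \<odot> a = (x \<odot> a) \<odot> y + ((x \<odot> a) \<odot> y + (x \<odot> y) \<odot> a)"
    by simp
  thus ?thesis unfolding right_linearized anticommute by (simp add: add_ac)
qed

section \<open>Derivations and their action modulo the unit\<close>

text \<open>
  The commutator $[L_a, R_b]$, which by alternativity is also the associator $x \mapsto (a, b, x)$.
\<close>

definition inner_der :: "'c \<Rightarrow> 'c \<Rightarrow> 'c \<Rightarrow> 'c" where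
  "inner_der a b x = a \<odot> (x \<odot> b) + (a \<odot> x) \<odot> b"

definition derivation :: "('c \<Rightarrow> 'c) \<Rightarrow> bool" where
  "derivation d \<longleftrightarrow> Vector_Spaces.linear sc sc d \<and> (\<forall>x y. d (x \<odot> y) = d x \<odot> y + x \<odot> d y)"

lemma derivation_iff:
  "derivation d \<longleftrightarrow> (\<forall>x y. d (x + y) = d x + d y) \<and> (\<forall>a x. d (a \<cdot> x) = a \<cdot> d x) \<and>
     (\<forall>x y. d (x \<odot> y) = d x \<odot> y + x \<odot> d y)"
  unfolding derivation_def Vector_Spaces.linear_iff using vector_space_axioms by auto

text \<open>
  Taking commutators in the two triality rules gives $D(xy) = [T_a, R_b](x)\,y + x\,[L_a, T_b](y)$ for
  $D = [L_a, R_b]$. For $a, b \in C_0$ both $[R_a, R_b]$ and $[L_a, L_b]$ are the scalar $b(a, b)$, so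
  each of the two commutators on the right is $D + b(a,b)$, and the two copies of $b(a,b)xy$ cancel.
\<close>

lemma derivation_inner_der:
  assumes "\<langle>a, e\<rangle> = 0" "\<langle>b, e\<rangle> = 0"
  shows "derivation (inner_der a b)"
proof -
  have "inner_der a b (x \<odot> y) = inner_der a b x \<odot> y + x \<odot> inner_der a b y" for x y
  proof -
    \<comment> \<open>Both halves of the commutator, expanded by the two triality rules.\<close>
    have 1: "a \<odot> ((x \<odot> y) \<odot> b) = (a \<odot> (x \<odot> b) + (x \<odot> b) \<odot> a) \<odot> y + (x \<odot> b) \<odot> (a \<odot> y)
        + (a \<odot> x + x \<odot> a) \<odot> (b \<odot> y + y \<odot> b) + x \<odot> (a \<odot> (b \<odot> y + y \<odot> b))"
      by (subst right_mult_triality[of x y b], subst mu_simps(2))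
        (simp only: left_mult_triality[of a "x \<odot> b" y] left_mult_triality[of a x "b \<odot> y + y \<odot> b"] add.assoc)
    have 2: "(a \<odot> (x \<odot> y)) \<odot> b = ((a \<odot> x + x \<odot> a) \<odot> b) \<odot> y + (a \<odot> x + x \<odot> a) \<odot> (b \<odot> y + y \<odot> b)
        + (x \<odot> b) \<odot> (a \<odot> y) + x \<odot> (b \<odot> (a \<odot> y) + (a \<odot> y) \<odot> b)"
      by (subst left_mult_triality[of a x y], subst mu_simps(1))
        (simp only: right_mult_triality[of "a \<odot> x + x \<odot> a" y b] right_mult_triality[of x "a \<odot> y" b] add.assoc)
    have r: "(x \<odot> b) \<odot> a = (x \<odot> a) \<odot> b + \<langle>a, b\<rangle> \<cdot> x"
      using right_linearized[of x a b] assms by (simp add: c_eq_iff[of "_ + _" "_ \<cdot> _"] c_eq_iff[of "(x \<odot> b) \<odot> a"] add_ac)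
    have l: "a \<odot> (b \<odot> y) = b \<odot> (a \<odot> y) + \<langle>a, b\<rangle> \<cdot> y"
      using left_linearized[of a b y] assms by (simp add: c_eq_iff[of "_ + _" "_ \<cdot> _"] c_eq_iff[of "a \<odot> (b \<odot> y)"] add_ac)
    show ?thesis unfolding inner_der_def 1 2 by (simp add: r l add_ac)
  qed
  thus ?thesis
    by (simp add: derivation_iff inner_der_def scale_right_distrib add_ac)
qed

text \<open>
  Group the two products into $a(cb) + c(ab)$, $c(ab) + (ab)c$ and $(ac)b + (ab)c$; each of these is given by
  a linearized quadratic law. The coefficient of $c$ is $b(ab,1) = b(a,b)$ and comes from the second sum.
\<close>

lemma inner_der_apply:
  assumes "\<langle>a, e\<rangle> = 0" "\<langle>b, e\<rangle> = 0" "\<langle>c, e\<rangle> = 0"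
  shows "inner_der a b c = \<langle>a, b\<rangle> \<cdot> c + \<langle>a, c\<rangle> \<cdot> b + \<langle>b, c\<rangle> \<cdot> a + \<langle>a \<odot> b, c\<rangle> \<cdot> e"
proof -
  have "inner_der a b c = (a \<odot> (c \<odot> b) + c \<odot> (a \<odot> b)) + (c \<odot> (a \<odot> b) + (a \<odot> b) \<odot> c)
      + ((a \<odot> c) \<odot> b + (a \<odot> b) \<odot> c)"
    by (simp add: inner_der_def add_ac)
  also have "\<langle>a \<odot> b, e\<rangle> = \<langle>a, b\<rangle>"
    using left_adjoint[of a b e] assms by (simp add: bil_sym)
  hence "(a \<odot> (c \<odot> b) + c \<odot> (a \<odot> b)) + (c \<odot> (a \<odot> b) + (a \<odot> b) \<odot> c) + ((a \<odot> c) \<odot> b + (a \<odot> b) \<odot> c)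
     = \<langle>a, b\<rangle> \<cdot> c + \<langle>a, c\<rangle> \<cdot> b + \<langle>b, c\<rangle> \<cdot> a + \<langle>a \<odot> b, c\<rangle> \<cdot> e"
    unfolding left_linearized right_linearized anticommute using assms
    by (simp add: bil_sym[of c] add_ac)
  finally show ?thesis .
qed

lemma e_nonzero: "e \<noteq> 0"
proof
  assume "e = 0"
  hence "x = 0" for x :: 'c using unit_left[of x] by simp
  hence "(UNIV :: 'c set) \<subseteq> span {}" by auto
  from dim_le_card[OF this] dim_8 show False by simp
qed

text \<open>
  That is, $C_0^\perp = \mathbb{F}1$: any $u$ with $b(1,u) = 1$ spans a complement of $C_0$, so
  $x + b(x,u)1$ is orthogonal to everything.
\<close>

lemma perp_perp_unit:
  assumes "\<And>y. \<langle>y, e\<rangle> = 0 \<Longrightarrow> \<langle>x, y\<rangle> = 0"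
  shows "\<exists>c. x = c \<cdot> e"
proof -
  obtain v where v: "\<langle>e, v\<rangle> \<noteq> 0" using e_nonzero nonsingular by blast
  define u where "u = inverse \<langle>e, v\<rangle> \<cdot> v"
  have u: "\<langle>e, u\<rangle> = 1" using v by (simp add: u_def)
  have "x = \<langle>x, u\<rangle> \<cdot> e"
  proof (rule eq_if_bil_eq)
    fix y
    have "\<langle>x, y + \<langle>y, e\<rangle> \<cdot> u\<rangle> = 0"
      by (rule assms) (simp add: u bil_sym[of u])
    thus "\<langle>x, y\<rangle> = \<langle>\<langle>x, u\<rangle> \<cdot> e, y\<rangle>"
      by (simp add: bil_sym[of e] mult.commute add_eq_0_iff)
  qed
  thus ?thesis ..
qed

lemma derivation_simps:
  assumes "derivation d"
  shows "d (x + y) = d x + d y" "d (a \<cdot> x) = a \<cdot> d x" "d (x \<odot> y) = d x \<odot> y + x \<odot> d y"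
    and "d e = 0"
proof -
  show "d (x + y) = d x + d y" "d (a \<cdot> x) = a \<cdot> d x"
    and m: "d (x \<odot> y) = d x \<odot> y + x \<odot> d y" for x y
    using assms by (auto simp: derivation_iff)
  show "d e = 0" using m[of e e] by simp
qed

text \<open>
  Derive $x^2 = b(x,1)x + q(x)1$ and compare with the linearized equation for the pair $x, dx$. This gives
  $b(dx,1)x = b(x,dx)1$, so both coefficients vanish unless $x$ is a multiple of 1, where $dx = 0$.
\<close>

lemma derivation_perp:
  assumes "derivation d"
  shows "\<langle>d x, e\<rangle> = 0" and "\<langle>x, d x\<rangle> = 0"
proof -
  note d = derivation_simps[OF assms]
  have "d (x \<odot> x) = \<langle>x, e\<rangle> \<cdot> d x"
    using left_quadratic[of x e] by (simp add: d del: d(3))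
  moreover have "d (x \<odot> x) = \<langle>x, e\<rangle> \<cdot> d x + \<langle>d x, e\<rangle> \<cdot> x + \<langle>x, d x\<rangle> \<cdot> e"
    unfolding d(3) using anticommute[of x "d x"] by (simp add: add.commute)
  ultimately have *: "\<langle>d x, e\<rangle> \<cdot> x = \<langle>x, d x\<rangle> \<cdot> e"
    by (simp add: add.assoc add_eq_0_iff)
  show 1: "\<langle>d x, e\<rangle> = 0"
  proof (rule ccontr)
    assume n: "\<langle>d x, e\<rangle> \<noteq> 0"
    have "x = inverse \<langle>d x, e\<rangle> \<cdot> (\<langle>d x, e\<rangle> \<cdot> x)" using n by simp
    also have "\<dots> = (inverse \<langle>d x, e\<rangle> * \<langle>x, d x\<rangle>) \<cdot> e" unfolding * by simp
    finally have "d x = d ((inverse \<langle>d x, e\<rangle> * \<langle>x, d x\<rangle>) \<cdot> e)" by (rule arg_cong)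
    hence "d x = 0" by (simp add: d)
    thus False using n by simp
  qed
  show "\<langle>x, d x\<rangle> = 0" using * e_nonzero unfolding 1 by simp
qed

lemma derivation_skew:
  assumes "derivation d"
  shows "\<langle>d x, y\<rangle> = \<langle>x, d y\<rangle>"
  using derivation_perp(2)[OF assms, of "x + y"] derivation_perp(2)[OF assms]
  by (simp add: derivation_simps[OF assms] bil_sym[of y] add_eq_0_iff)

section \<open>A symplectic basis adapted to the unit\<close>

definition hyperbolic :: "nat \<Rightarrow> (nat \<Rightarrow> 'c) \<Rightarrow> (nat \<Rightarrow> 'c) \<Rightarrow> bool" where
  "hyperbolic k X Y \<longleftrightarrow> (\<forall>i<k. \<forall>j<k. \<langle>X i, X j\<rangle> = 0 \<and> \<langle>Y i, Y j\<rangle> = 0 \<and>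
     \<langle>X i, Y j\<rangle> = (if i = j then 1 else 0))"

text \<open>
  The orthogonal projection onto the span of $k$ hyperbolic pairs.
\<close>

definition hyp_proj :: "nat \<Rightarrow> (nat \<Rightarrow> 'c) \<Rightarrow> (nat \<Rightarrow> 'c) \<Rightarrow> 'c \<Rightarrow> 'c" where
  "hyp_proj k X Y z = (\<Sum>i<k. \<langle>z, Y i\<rangle> \<cdot> X i + \<langle>z, X i\<rangle> \<cdot> Y i)"

lemma bil_sum: "\<langle>sum f A, z\<rangle> = (\<Sum>i\<in>A. \<langle>f i, z\<rangle>)"
  by (induction A rule: infinite_finite_induct) simp_all

lemma bil_hyp_proj:
  assumes "hyperbolic k X Y" "i < k"
  shows "\<langle>hyp_proj k X Y z, X i\<rangle> = \<langle>z, X i\<rangle>" "\<langle>hyp_proj k X Y z, Y i\<rangle> = \<langle>z, Y i\<rangle>"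
proof -
  have "\<langle>hyp_proj k X Y z, X i\<rangle> = (\<Sum>j<k. if i = j then \<langle>z, X j\<rangle> else 0)"
    unfolding hyp_proj_def bil_sum
    by (rule sum.cong) (use assms in \<open>auto simp: hyperbolic_def bil_sym[of "Y _" "X _"]\<close>)
  thus "\<langle>hyp_proj k X Y z, X i\<rangle> = \<langle>z, X i\<rangle>" using assms(2) by simp
  have "\<langle>hyp_proj k X Y z, Y i\<rangle> = (\<Sum>j<k. if i = j then \<langle>z, Y j\<rangle> else 0)"
    unfolding hyp_proj_def bil_sum
    by (rule sum.cong) (use assms in \<open>auto simp: hyperbolic_def\<close>)
  thus "\<langle>hyp_proj k X Y z, Y i\<rangle> = \<langle>z, Y i\<rangle>" using assms(2) by simp
qed

lemma hyperbolic_extend: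
  assumes h: "hyperbolic k X Y" and z: "hyp_proj k X Y z \<noteq> z"
  shows "\<exists>x y. hyperbolic (Suc k) (X(k := x)) (Y(k := y))"
proof -
  define x where "x = z + hyp_proj k X Y z"
  have x0: "\<langle>x, X i\<rangle> = 0" "\<langle>x, Y i\<rangle> = 0" if "i < k" for i
    using bil_hyp_proj[OF h that] by (simp_all add: x_def)
  have "x \<noteq> 0" using z by (auto simp: x_def add_eq_0_iff)
  then obtain t where t: "\<langle>x, t\<rangle> \<noteq> 0" using nonsingular by blast
  define y where "y = inverse \<langle>x, t\<rangle> \<cdot> (t + hyp_proj k X Y t)"
  have y0: "\<langle>y, X i\<rangle> = 0" "\<langle>y, Y i\<rangle> = 0" if "i < k" for i
    using bil_hyp_proj[OF h that] by (simp_all add: y_def)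
  have "\<langle>hyp_proj k X Y t, x\<rangle> = 0"
    unfolding hyp_proj_def bil_sum by (rule sum.neutral) (simp add: x0 bil_sym[of _ x])
  hence xy: "\<langle>x, y\<rangle> = 1" using t by (simp add: y_def bil_sym[of _ x])
  have "hyperbolic (Suc k) (X(k := x)) (Y(k := y))"
    using h x0 y0 xy x0[unfolded bil_sym[of x]] y0[unfolded bil_sym[of y]]
    by (auto simp: hyperbolic_def less_Suc_eq)
  thus ?thesis by blast
qed

lemma independent_if_dual:
  assumes "\<And>x. x \<in> S \<Longrightarrow> \<exists>w. \<langle>x, w\<rangle> \<noteq> 0 \<and> (\<forall>y\<in>S - {x}. \<langle>y, w\<rangle> = 0)"
  shows "independent S"
  unfolding dependent_def
proof safe
  fix x assume x: "x \<in> S" "x \<in> span (S - {x})"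
  obtain w where w: "\<langle>x, w\<rangle> \<noteq> 0" "\<forall>y\<in>S - {x}. \<langle>y, w\<rangle> = 0" using assms x by blast
  have "\<langle>x, w\<rangle> = 0"
    by (rule span_induct[OF x(2)]) (use w in \<open>auto simp: subspace_def\<close>)
  with w show False by simp
qed

text \<open>
  The partner of each vector in its hyperbolic pair is orthogonal to all the others, so $k$ pairs are $2k$ independent vectors
  in a space of dimension 8.
\<close>

lemma hyperbolic_le_4:
  assumes h: "hyperbolic k X Y"
  shows "k \<le> 4"
proof -
  let ?X = "X ` {..<k}" and ?Y = "Y ` {..<k}"
  have XY: "\<langle>X i, X j\<rangle> = 0" "\<langle>Y i, Y j\<rangle> = 0" "\<langle>X i, Y j\<rangle> = (if i = j then 1 else 0)"
    "\<langle>Y j, X i\<rangle> = (if i = j then 1 else 0)" if "i < k" "j < k" for i j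
    using h that by (auto simp: hyperbolic_def bil_sym[of "Y _" "X _"])
  have "inj_on X {..<k}" "inj_on Y {..<k}"
    by (rule inj_onI; metis XY(3,4) lessThan_iff zero_neq_one)+
  moreover have "?X \<inter> ?Y = {}"
    by auto (metis XY(2,3) zero_neq_one)
  ultimately have card: "card (?X \<union> ?Y) = 2 * k"
    by (simp add: card_Un_disjoint card_image)
  have "independent (?X \<union> ?Y)"
  proof (rule independent_if_dual)
    fix x assume "x \<in> ?X \<union> ?Y"
    then consider i where "i < k" "x = X i" | i where "i < k" "x = Y i" by auto
    thus "\<exists>w. \<langle>x, w\<rangle> \<noteq> 0 \<and> (\<forall>y\<in>?X \<union> ?Y - {x}. \<langle>y, w\<rangle> = 0)"
    proof cases
      case 1 thus ?thesis by (intro exI[of _ "Y i"]) (auto simp: XY split: if_splits)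
    next
      case 2 thus ?thesis by (intro exI[of _ "X i"]) (auto simp: XY split: if_splits)
    qed
  qed
  moreover obtain B where B: "independent B" "UNIV \<subseteq> span B" "card B = 8"
    using basis_exists[of UNIV] dim_8 by metis
  moreover have "finite B" using B(3) by (metis card.infinite zero_neq_numeral)
  ultimately show ?thesis
    using independent_span_bound[of B "?X \<union> ?Y"] card by auto
qed

lemma hyperbolic_spans:
  assumes "hyperbolic 4 X Y"
  shows "hyp_proj 4 X Y z = z"
  using hyperbolic_extend[OF assms, of z] hyperbolic_le_4 by force

text \<open>
  Symplectic Gram--Schmidt, with 1 as the first vector of the first pair.
\<close>

lemma hyperbolic_exists:
  assumes "1 \<le> k" "k \<le> 4"
  shows "\<exists>X Y. hyperbolic k X Y \<and> X 0 = e"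
  using assms
proof (induction k rule: dec_induct)
  case base
  obtain v where v: "\<langle>e, v\<rangle> \<noteq> 0" using e_nonzero nonsingular by blast
  show ?case
    by (rule exI[of _ "\<lambda>_. e"], rule exI[of _ "\<lambda>_. inverse \<langle>e, v\<rangle> \<cdot> v"])
      (use v in \<open>simp add: hyperbolic_def\<close>)
next
  case (step k)
  then obtain X Y where XY: "hyperbolic k X Y" "X 0 = e" by auto
  have "\<exists>z. hyp_proj k X Y z \<noteq> z"
  proof (rule ccontr)
    assume "\<not> ?thesis"
    hence z: "z = (\<Sum>i<k. \<langle>z, Y i\<rangle> \<cdot> X i + \<langle>z, X i\<rangle> \<cdot> Y i)" for z by (simp add: hyp_proj_def)
    have "z \<in> span (X ` {..<k} \<union> Y ` {..<k})" for z
      by (subst z) (intro span_sum span_add span_scale span_base; auto)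
    hence "dim (UNIV :: 'c set) \<le> card (X ` {..<k} \<union> Y ` {..<k})"
      by (intro dim_le_card) auto
    also have "\<dots> \<le> card (X ` {..<k}) + card (Y ` {..<k})" by (rule card_Un_le)
    also have "\<dots> \<le> k + k"
      using card_image_le[of "{..<k}" X] card_image_le[of "{..<k}" Y] by simp
    finally show False using dim_8 step.prems by simp
  qed
  then obtain x y where "hyperbolic (Suc k) (X(k := x)) (Y(k := y))"
    using hyperbolic_extend[OF XY(1)] by blast
  moreover have "(X(k := x)) 0 = e" using step.hyps XY(2) by simp
  ultimately show ?case by blast
qed

end

text \<open>
  A frame is a symplectic basis of $W$, lifted to $C_0$. The vectors $e_1, e_2, e_3, f_1, f_2, f_3$
  are to be read as the bivectors 12, 13, 14, 34, 24, 23 of a basis of $\mathbb{F}^4$, each $f_i$ being complementary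
  to $e_i$. The vector $u$ only serves to name the coefficient of 1 in an element of $C_0$.
\<close>

locale cayley_frame = cayley_char2 sc mu q e
  for sc :: "'k::field \<Rightarrow> 'c::ab_group_add \<Rightarrow> 'c" (infixr "\<cdot>" 75)
    and mu :: "'c \<Rightarrow> 'c \<Rightarrow> 'c" (infixl "\<odot>" 70)
    and q :: "'c \<Rightarrow> 'k"
    and e :: 'c +
  fixes e1 e2 e3 f1 f2 f3 u :: 'c
  assumes frame_perp: "\<langle>e1, e\<rangle> = 0" "\<langle>e2, e\<rangle> = 0" "\<langle>e3, e\<rangle> = 0"
      "\<langle>f1, e\<rangle> = 0" "\<langle>f2, e\<rangle> = 0" "\<langle>f3, e\<rangle> = 0"
    and frame_dual: "\<langle>e1, f1\<rangle> = 1" "\<langle>e2, f2\<rangle> = 1" "\<langle>e3, f3\<rangle> = 1"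
    and frame_orth: "\<langle>e1, e2\<rangle> = 0" "\<langle>e1, e3\<rangle> = 0" "\<langle>e2, e3\<rangle> = 0"
      "\<langle>f1, f2\<rangle> = 0" "\<langle>f1, f3\<rangle> = 0" "\<langle>f2, f3\<rangle> = 0"
      "\<langle>e1, f2\<rangle> = 0" "\<langle>e1, f3\<rangle> = 0" "\<langle>e2, f1\<rangle> = 0" "\<langle>e2, f3\<rangle> = 0" "\<langle>e3, f1\<rangle> = 0" "\<langle>e3, f2\<rangle> = 0"
    and frame_expand: "\<langle>z, e\<rangle> = 0 \<Longrightarrow> z = \<langle>z, f1\<rangle> \<cdot> e1 + \<langle>z, f2\<rangle> \<cdot> e2 + \<langle>z, f3\<rangle> \<cdot> e3 +
      \<langle>z, e1\<rangle> \<cdot> f1 + \<langle>z, e2\<rangle> \<cdot> f2 + \<langle>z, e3\<rangle> \<cdot> f3 + \<langle>z, u\<rangle> \<cdot> e"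

context cayley_char2 begin

lemma cayley_frame_exists: "\<exists>e1 e2 e3 f1 f2 f3 u. cayley_frame sc mu q e e1 e2 e3 f1 f2 f3 u"
proof -
  obtain X Y where h: "hyperbolic 4 X Y" and X0: "X 0 = e" using hyperbolic_exists[of 4] by auto
  have XY: "\<langle>X i, X j\<rangle> = 0" "\<langle>Y i, Y j\<rangle> = 0" "\<langle>X i, Y j\<rangle> = (if i = j then 1 else 0)"
    "\<langle>Y j, X i\<rangle> = (if i = j then 1 else 0)" if "i < 4" "j < 4" for i j
    using h that by (auto simp: hyperbolic_def bil_sym[of "Y _" "X _"])
  have "cayley_frame sc mu q e (X 1) (X 2) (X 3) (Y 1) (Y 2) (Y 3) (Y 0)"
  proof
    fix z assume z: "\<langle>z, e\<rangle> = 0"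
    show "z = \<langle>z, Y 1\<rangle> \<cdot> X 1 + \<langle>z, Y 2\<rangle> \<cdot> X 2 + \<langle>z, Y 3\<rangle> \<cdot> X 3 +
      \<langle>z, X 1\<rangle> \<cdot> Y 1 + \<langle>z, X 2\<rangle> \<cdot> Y 2 + \<langle>z, X 3\<rangle> \<cdot> Y 3 + \<langle>z, Y 0\<rangle> \<cdot> e"
      using hyperbolic_spans[OF h, of z] z
      by (simp add: hyp_proj_def eval_nat_numeral X0 add_ac)
  qed (simp_all add: XY flip: X0)
  thus ?thesis by blast
qed

end

context cayley_frame begin

lemmas frame_bil [simp] =
  frame_perp frame_dual frame_orth
  frame_perp[THEN trans[OF bil_sym]] frame_dual[THEN trans[OF bil_sym]] frame_orth[THEN trans[OF bil_sym]]

text \<open>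
  Equality in $W$; elements of $W$ are represented in $C_0$ throughout.
\<close>

definition unit_cong :: "'c \<Rightarrow> 'c \<Rightarrow> bool" (infix "\<doteq>" 50) where
  "x \<doteq> y \<longleftrightarrow> (\<exists>c. x = y + c \<cdot> e)"

lemma unit_cong_iff:
  assumes "\<langle>x, e\<rangle> = 0" "\<langle>y, e\<rangle> = 0"
  shows "x \<doteq> y \<longleftrightarrow> \<langle>x, e1\<rangle> = \<langle>y, e1\<rangle> \<and> \<langle>x, e2\<rangle> = \<langle>y, e2\<rangle> \<and> \<langle>x, e3\<rangle> = \<langle>y, e3\<rangle> \<and>
    \<langle>x, f1\<rangle> = \<langle>y, f1\<rangle> \<and> \<langle>x, f2\<rangle> = \<langle>y, f2\<rangle> \<and> \<langle>x, f3\<rangle> = \<langle>y, f3\<rangle>" (is "_ = ?R")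
proof
  show "x \<doteq> y \<Longrightarrow> ?R" by (auto simp: unit_cong_def)
next
  assume R: ?R
  define z where "z = x + y"
  have "\<langle>z, e\<rangle> = 0" "\<langle>z, e1\<rangle> = 0" "\<langle>z, e2\<rangle> = 0" "\<langle>z, e3\<rangle> = 0" "\<langle>z, f1\<rangle> = 0" "\<langle>z, f2\<rangle> = 0" "\<langle>z, f3\<rangle> = 0"
    using R assms by (simp_all add: z_def)
  hence "z = \<langle>z, u\<rangle> \<cdot> e" using frame_expand[of z] by simp
  hence "x + y = \<langle>x + y, u\<rangle> \<cdot> e" unfolding z_def .
  hence "x = y + \<langle>x + y, u\<rangle> \<cdot> e" by (metis add.commute c_double_left)
  thus "x \<doteq> y" unfolding unit_cong_def by blast
qed

section \<open>The derivation attached to a matrix of trace zero\<close>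

text \<open>
  Write $\theta_{ij}$ for the bivector $ij$. For distinct $i, j, k, l$ the operator \<open>inner_der\<close> of
  $\theta_{ik}$ and $\theta_{il}$ acts on $W$ as the matrix unit $E_{ij}$, and that of $\theta_{ij}$ and
  $\theta_{kl}$ acts as $E_{ii} + E_{jj}$. A diagonal matrix of trace 0 differs from
  $(a_2 + a_4)(E_{11} + E_{22}) + (a_3 + a_4)(E_{11} + E_{33})$ by the scalar matrix $a_4$, which acts as 0.
\<close>

definition sl_der :: "'k^4^4 \<Rightarrow> 'c \<Rightarrow> 'c" where
  "sl_der A x =
     A$1$2 \<cdot> inner_der e2 e3 x + A$1$3 \<cdot> inner_der e1 e3 x + A$1$4 \<cdot> inner_der e1 e2 x +
     A$2$1 \<cdot> inner_der f2 f3 x + A$2$3 \<cdot> inner_der e1 f2 x + A$2$4 \<cdot> inner_der e1 f3 x +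
     A$3$1 \<cdot> inner_der f1 f3 x + A$3$2 \<cdot> inner_der e2 f1 x + A$3$4 \<cdot> inner_der e2 f3 x +
     A$4$1 \<cdot> inner_der f1 f2 x + A$4$2 \<cdot> inner_der e3 f1 x + A$4$3 \<cdot> inner_der e3 f2 x +
     (A$2$2 + A$4$4) \<cdot> inner_der e1 f1 x + (A$3$3 + A$4$4) \<cdot> inner_der e2 f2 x"

lemma derivation_add: "derivation d \<Longrightarrow> derivation d' \<Longrightarrow> derivation (\<lambda>x. d x + d' x)"
  by (simp add: derivation_iff scale_right_distrib add_ac)

lemma derivation_scale: "derivation d \<Longrightarrow> derivation (\<lambda>x. a \<cdot> d x)"
  by (simp add: derivation_iff scale_right_distrib mult.commute)

lemma derivation_sl_der: "derivation (sl_der A)"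
  unfolding sl_der_def [abs_def]
  by (intro derivation_add derivation_scale derivation_inner_der frame_perp)

lemma bil_inner_der:
  assumes "\<langle>a, e\<rangle> = 0" "\<langle>b, e\<rangle> = 0" "\<langle>c, e\<rangle> = 0" "\<langle>w, e\<rangle> = 0"
  shows "\<langle>inner_der a b c, w\<rangle> = \<langle>a, b\<rangle> * \<langle>c, w\<rangle> + \<langle>a, c\<rangle> * \<langle>b, w\<rangle> + \<langle>b, c\<rangle> * \<langle>a, w\<rangle>"
  using assms by (simp add: inner_der_apply bil_sym[of e])

definition wedge :: "'k^4 \<Rightarrow> 'k^4 \<Rightarrow> 'c" where
  "wedge p r = (p$1 * r$2 + p$2 * r$1) \<cdot> e1 + (p$1 * r$3 + p$3 * r$1) \<cdot> e2 +
     (p$1 * r$4 + p$4 * r$1) \<cdot> e3 + (p$3 * r$4 + p$4 * r$3) \<cdot> f1 +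
     (p$2 * r$4 + p$4 * r$2) \<cdot> f2 + (p$2 * r$3 + p$3 * r$2) \<cdot> f3"

lemma wedge_perp: "\<langle>wedge p r, e\<rangle> = 0"
  by (simp add: wedge_def)

lemma wedge_add:
  "wedge (p + p') r = wedge p r + wedge p' r" "wedge p (r + r') = wedge p r + wedge p r'"
  by (simp_all add: wedge_def algebra_simps)

text \<open>
  The map $d$ acts on $W = \Lambda^2 \mathbb{F}^4$ as $A$ does.
\<close>

definition induces :: "('c \<Rightarrow> 'c) \<Rightarrow> 'k^4^4 \<Rightarrow> bool" where
  "induces d A \<longleftrightarrow> (\<forall>p r. d (wedge p r) \<doteq> wedge (A *v p) r + wedge p (A *v r))"

lemma matvec4: "((A :: 'k^4^4) *v p) $ i = A$i$1 * p$1 + A$i$2 * p$2 + A$i$3 * p$3 + A$i$4 * p$4"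
  by (simp add: matrix_vector_mult_def sum_4)

lemma induces_sl_der:
  assumes "trace A = 0"
  shows "induces (sl_der A) A"
  unfolding induces_def
proof (intro allI)
  fix p r
  have tr: "A$1$1 = A$2$2 + A$3$3 + A$4$4"
    using assms by (simp add: trace_def sum_4 add_eq_0_iff add.assoc)
  have *: "\<langle>wedge (A *v p) r + wedge p (A *v r), e\<rangle> = 0" by (simp add: wedge_perp)
  show "sl_der A (wedge p r) \<doteq> wedge (A *v p) r + wedge p (A *v r)"
    unfolding unit_cong_iff[OF derivation_perp(1)[OF derivation_sl_der] *]
    by (simp add: sl_der_def bil_inner_der wedge_perp)
      (simp add: wedge_def matvec4 tr algebra_simps)
qed

text \<open>
  Multiples of 1 can be ignored when two derivations are composed, since derivations kill 1.
\<close>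

lemma induces_bracket:
  assumes d: "derivation d" "induces d A" and d': "derivation d'" "induces d' A'"
  shows "induces (\<lambda>x. d (d' x) - d' (d x)) (A ** A' - A' ** A)"
  unfolding induces_def
proof (intro allI)
  fix p r
  obtain h where h: "d (wedge p r) = wedge (A *v p) r + wedge p (A *v r) + h p r \<cdot> e" for p r
    using d(2) unfolding induces_def unit_cong_def by metis
  obtain h' where h': "d' (wedge p r) = wedge (A' *v p) r + wedge p (A' *v r) + h' p r \<cdot> e" for p r
    using d'(2) unfolding induces_def unit_cong_def by metis
  have eq: "(A ** A' - A' ** A) *v p = A *v (A' *v p) + A' *v (A *v p)" for p
    by (simp add: matrix_vector_mult_diff_rdistrib matrix_vector_mul_assoc vec_eq_iff)
  have "d (d' (wedge p r)) - d' (d (wedge p r)) =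
     wedge ((A ** A' - A' ** A) *v p) r + wedge p ((A ** A' - A' ** A) *v r) +
     (h (A' *v p) r + h p (A' *v r) + h' (A *v p) r + h' p (A *v r)) \<cdot> e"
    unfolding h h' derivation_simps[OF d(1)] derivation_simps[OF d'(1)] eq wedge_add
    by (simp add: scale_left_distrib add_ac)
  thus "d (d' (wedge p r)) - d' (d (wedge p r)) \<doteq>
      wedge ((A ** A' - A' ** A) *v p) r + wedge p ((A ** A' - A' ** A) *v r)"
    unfolding unit_cong_def by blast
qed

lemma unit_cong_zero_iff: "x \<doteq> 0 \<longleftrightarrow> (\<exists>c. x = c \<cdot> e)"
  by (simp add: unit_cong_def)

lemma derivation_perp_pairing:
  assumes d: "derivation d" and x: "\<langle>x, e\<rangle> = 0" and dy: "d y \<doteq> s \<cdot> y"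
  shows "\<langle>d x, y\<rangle> = s * \<langle>x, y\<rangle>"
proof -
  obtain c where "d y = s \<cdot> y + c \<cdot> e" using dy unfolding unit_cong_def by blast
  thus ?thesis using x by (simp add: derivation_skew[OF d])
qed

lemma derivation_scalar_on_frame:
  assumes d: "derivation d"
    and fr: "d e1 \<doteq> s \<cdot> e1" "d e2 \<doteq> s \<cdot> e2" "d e3 \<doteq> s \<cdot> e3"
      "d f1 \<doteq> s \<cdot> f1" "d f2 \<doteq> s \<cdot> f2" "d f3 \<doteq> s \<cdot> f3"
    and x: "\<langle>x, e\<rangle> = 0"
  shows "d x \<doteq> s \<cdot> x"
proof -
  have "\<langle>d x, e\<rangle> = 0" "\<langle>s \<cdot> x, e\<rangle> = 0" using derivation_perp(1)[OF d] x by simp_all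
  thus ?thesis
    by (simp add: unit_cong_iff fr[THEN derivation_perp_pairing[OF d x]])
qed

section \<open>Every derivation comes from a matrix\<close>

text \<open>
  If $s \neq 0$, then $H = d(C_0)$ is the $s$-eigenspace of $d$ in $C_0$ and represents $W$ faithfully. For
  orthogonal $x, y \in H$ the product $xy$ lies in $C_0$ and $d(xy) = 2s\,xy = 0$, so
  $s\,xy \in \mathbb{F}1$. Then $q(x)y = x(xy)$ is a multiple of $x$, which forces $q(x) = 0$ as soon as $y$ can be chosen
  independent of $x$. Applied to $e_1$, $f_1$ and $e_1 + f_1$, this contradicts $b(e_1, f_1) = 1$.
\<close>

lemma derivation_mod_unit_scalar_zero:
  assumes d: "derivation d" and s: "\<And>x. \<langle>x, e\<rangle> = 0 \<Longrightarrow> d x \<doteq> s \<cdot> x"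
  shows "s = 0"
proof (rule ccontr)
  assume nz: "s \<noteq> 0"
  note ds = derivation_simps[OF d]
  \<comment> \<open>The projection of \<open>C\<^sub>0\<close> onto the eigenspace of \<open>d\<close> along the unit.\<close>
  define g where "g x = inverse s \<cdot> d x" for x
  have g: "d (g x) = s \<cdot> g x" "\<langle>g x, e\<rangle> = 0" "\<exists>c. g x = x + c \<cdot> e" if x: "\<langle>x, e\<rangle> = 0" for x
  proof -
    obtain c where c: "d x = s \<cdot> x + c \<cdot> e" using s[OF x] unfolding unit_cong_def by blast
    have "d (d x) = d (s \<cdot> x + c \<cdot> e)" by (simp only: c)
    also have "\<dots> = s \<cdot> d x" by (simp only: ds scale_zero_right add_0_right)
    finally show "d (g x) = s \<cdot> g x" by (simp add: g_def ds mult.commute)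
    show "\<exists>c. g x = x + c \<cdot> e" using nz by (auto simp: g_def c scale_right_distrib)
    show "\<langle>g x, e\<rangle> = 0" using derivation_perp(1)[OF d] by (simp add: g_def)
  qed
  have g_add: "g (x + y) = g x + g y" for x y by (simp add: g_def ds scale_right_distrib)
  have bil_g: "\<langle>g x, g y\<rangle> = \<langle>x, y\<rangle>" if "\<langle>x, e\<rangle> = 0" "\<langle>y, e\<rangle> = 0" for x y
    using g(3)[OF that(1)] g(3)[OF that(2)] that by (auto simp: bil_sym[of e])
  have isotropic: "q (g x) = 0" if x: "\<langle>x, e\<rangle> = 0" "\<langle>x, e2\<rangle> = 0" "\<langle>x, f2\<rangle> = 0" for x
  proof (rule ccontr)
    assume qx: "q (g x) \<noteq> 0"
    define m where "m = g x \<odot> g e2"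
    have "\<langle>m, e\<rangle> = 0"
      using left_adjoint[of "g x" "g e2" e] g(2)[OF x(1)] g(2)[of e2] bil_g[of e2 x] x
      by (simp add: m_def bil_sym[of e2])
    from s[OF this] obtain c where c: "d m = s \<cdot> m + c \<cdot> e" unfolding unit_cong_def by blast
    have "d m = 0" by (simp add: m_def ds g(1)[OF x(1)] g(1)[of e2])
    hence "s \<cdot> m = c \<cdot> e" using c by (simp add: add_eq_0_iff)
    hence "m = (inverse s * c) \<cdot> e" using nz by (metis scale_scale left_inverse scale_one)
    hence "g x \<odot> m = (inverse s * c) \<cdot> g x" by simp
    moreover have "g x \<odot> m = q (g x) \<cdot> g e2"
      using left_quadratic[of "g x" "g e2"] g(2)[OF x(1)] by (simp add: m_def)
    ultimately have "\<langle>q (g x) \<cdot> g e2, g f2\<rangle> = \<langle>(inverse s * c) \<cdot> g x, g f2\<rangle>" by simp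
    thus False using qx x bil_g[of e2 f2] bil_g[of x f2] by simp
  qed
  have "q (g e1 + g f1) = 0" "q (g e1) = 0" "q (g f1) = 0"
    using isotropic[of "e1 + f1"] isotropic[of e1] isotropic[of f1] by (simp_all add: g_add)
  thus False using bil_g[of e1 f1] by (simp add: q_add)
qed

text \<open>
  For orthogonal $x, y \in C_0$, deriving $xy \in C_0$ gives $d(x)y + x\,d(y) \in \mathbb{F}1$ with $dx, dy \in \mathbb{F}1$;
  if 1, $x$, $y$ are independent, then $dx = dy = 0$. This settles $C_0$. By skewness, the
  image of $d$ is then orthogonal to $C_0$, so $dx$ is a multiple of 1, and deriving
  $x^2 = b(x,1)x + q(x)1$ gives $b(x,1)\,dx = 2x\,dx = 0$.
\<close>

lemma derivation_eq_zero:
  assumes d: "derivation d" and s: "\<And>x. \<langle>x, e\<rangle> = 0 \<Longrightarrow> d x \<doteq> 0"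
  shows "d x = 0"
proof -
  note ds = derivation_simps[OF d]
  have *: "d x = 0"
    if x: "\<langle>x, e\<rangle> = 0" and y: "\<langle>y, e\<rangle> = 0" and z: "\<langle>z, e\<rangle> = 0"
      and xy: "\<langle>x, y\<rangle> = 0" and yz: "\<langle>y, z\<rangle> = 1" and xz: "\<langle>x, z\<rangle> = 0" for x y z
  proof -
    have "\<langle>x \<odot> y, e\<rangle> = 0" using left_adjoint[of x y e] x xy by (simp add: bil_sym[of y])
    then obtain a b c where a: "d x = a \<cdot> e" and b: "d y = b \<cdot> e" and c: "d (x \<odot> y) = c \<cdot> e"
      using s x y unfolding unit_cong_zero_iff by metis
    have "c \<cdot> e = a \<cdot> y + b \<cdot> x" using ds(3)[of x y] by (simp add: a b c)
    hence "\<langle>c \<cdot> e, z\<rangle> = \<langle>a \<cdot> y + b \<cdot> x, z\<rangle>" by simp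
    hence "a = 0" using yz xz z by (simp add: bil_sym[of e])
    thus ?thesis by (simp add: a)
  qed
  have "d e1 = 0" "d e3 = 0" "d f1 = 0" "d f3 = 0"
    using *[of _ e2 f2] by simp_all
  moreover have "d e2 = 0" "d f2 = 0"
    using *[of _ e1 f1] by simp_all
  ultimately have perp: "d y = 0" if "\<langle>y, e\<rangle> = 0" for y
    by (subst frame_expand[OF that]) (simp add: ds)
  obtain c where c: "d x = c \<cdot> e"
    using perp_perp_unit[of "d x"] derivation_skew[OF d, of x] perp by (metis bil_zero(2))
  have "d (x \<odot> x) = \<langle>x, e\<rangle> \<cdot> d x"
    using left_quadratic[of x e] by (simp add: ds del: ds(3))
  moreover have "d (x \<odot> x) = 0" by (simp add: ds c)
  ultimately show ?thesis using perp[of x] by (cases "\<langle>x, e\<rangle> = 0") auto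
qed

text \<open>
  The matrix is read off from the coefficients of $d$ in the frame. Off the diagonal, $A_{ij}$ is the coefficient of
  $\theta_{im}$ in $d\theta_{jm}$. On the diagonal, let $c_i$ be the coefficient of $e_i$ in $d e_i$; the
  entries $0, c_1, c_2, c_3$ would match the action on the $e_i$, but their sum $s = c_1 + c_2 + c_3$ need not be 0. Adding $s$ to
  the last three makes the trace $4s = 0$ and leaves $d$ equal to \<open>sl_der A\<close> plus the scalar $s$ on $W$.
\<close>

lemma derivation_is_sl_der:
  assumes d: "derivation d"
  shows "\<exists>A. trace A = 0 \<and> sl_der A = d"
proof -
  note skew = derivation_skew[OF d]
  define A :: "'k^4^4" where "A = (\<chi> i j.
    if i = 1 then (if j = 1 then 0 else if j = 2 then \<langle>d f2, f3\<rangle> else if j = 3 then \<langle>d f1, f3\<rangle> else \<langle>d f1, f2\<rangle>)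
    else if i = 2 then (if j = 1 then \<langle>d e2, e3\<rangle> else if j = 2 then \<langle>d e2, f2\<rangle> + \<langle>d e3, f3\<rangle> else if j = 3 then \<langle>d e2, f1\<rangle> else \<langle>d e3, f1\<rangle>)
    else if i = 3 then (if j = 1 then \<langle>d e1, e3\<rangle> else if j = 2 then \<langle>d e1, f2\<rangle> else if j = 3 then \<langle>d e1, f1\<rangle> + \<langle>d e3, f3\<rangle> else \<langle>d e3, f2\<rangle>)
    else (if j = 1 then \<langle>d e1, e2\<rangle> else if j = 2 then \<langle>d e1, f3\<rangle> else if j = 3 then \<langle>d e2, f3\<rangle> else \<langle>d e1, f1\<rangle> + \<langle>d e2, f2\<rangle>))"
  define s where "s = \<langle>d e1, f1\<rangle> + \<langle>d e2, f2\<rangle> + \<langle>d e3, f3\<rangle>"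
  define h where "h x = d x + sl_der A x" for x
  have h: "derivation h"
    unfolding h_def [abs_def] by (intro derivation_add d derivation_sl_der)
  have sk: "\<langle>d f1, e1\<rangle> = \<langle>d e1, f1\<rangle>" "\<langle>d f2, e2\<rangle> = \<langle>d e2, f2\<rangle>" "\<langle>d f3, e3\<rangle> = \<langle>d e3, f3\<rangle>"
    "\<langle>d e2, e1\<rangle> = \<langle>d e1, e2\<rangle>" "\<langle>d e3, e1\<rangle> = \<langle>d e1, e3\<rangle>" "\<langle>d e3, e2\<rangle> = \<langle>d e2, e3\<rangle>"
    "\<langle>d f2, f1\<rangle> = \<langle>d f1, f2\<rangle>" "\<langle>d f3, f1\<rangle> = \<langle>d f1, f3\<rangle>" "\<langle>d f3, f2\<rangle> = \<langle>d f2, f3\<rangle>"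
    "\<langle>d f2, e1\<rangle> = \<langle>d e1, f2\<rangle>" "\<langle>d f3, e1\<rangle> = \<langle>d e1, f3\<rangle>" "\<langle>d f1, e2\<rangle> = \<langle>d e2, f1\<rangle>"
    "\<langle>d f3, e2\<rangle> = \<langle>d e2, f3\<rangle>" "\<langle>d f1, e3\<rangle> = \<langle>d e3, f1\<rangle>" "\<langle>d f2, e3\<rangle> = \<langle>d e3, f2\<rangle>"
    using skew by (simp_all add: bil_sym[of _ "d _"])
  have alt: "\<langle>d x, x\<rangle> = 0" for x using derivation_perp(2)[OF d, of x] by (simp add: bil_sym)
  have he: "\<langle>h x, e\<rangle> = 0" for x using derivation_perp(1)[OF h] .
  have fr: "h x \<doteq> s \<cdot> x" if "x \<in> {e1, e2, e3, f1, f2, f3}" for x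
  proof -
    have sx: "\<langle>s \<cdot> x, e\<rangle> = 0" using that by auto
    show ?thesis unfolding unit_cong_iff[OF he sx] using that
      by (elim insertE emptyE)
        (simp_all add: h_def sl_der_def bil_inner_der A_def s_def sk alt add_ac)
  qed
  have hs: "h x \<doteq> s \<cdot> x" if "\<langle>x, e\<rangle> = 0" for x
    by (rule derivation_scalar_on_frame[OF h fr fr fr fr fr fr that]) simp_all
  hence "s = 0" by (rule derivation_mod_unit_scalar_zero[OF h])
  with hs have "h x = 0" for x using derivation_eq_zero[OF h] by simp
  hence "sl_der A = d" by (auto simp: h_def fun_eq_iff add_eq_0_iff)
  moreover have "trace A = 0" by (simp add: trace_def sum_4 A_def add_ac)
  ultimately show ?thesis by blast
qed

lemma sl_der_eq_zero_iff:
  assumes tr: "trace A = 0"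
  shows "sl_der A = (\<lambda>x. 0) \<longleftrightarrow> A \<in> scalar_matrices"
proof
  assume "sl_der A = (\<lambda>x. 0)"
  hence 0: "\<langle>sl_der A x, y\<rangle> = 0" for x y by simp
  have "A$1$2 = 0" "A$1$3 = 0" "A$1$4 = 0" "A$2$1 = 0" "A$2$3 = 0" "A$2$4 = 0"
    "A$3$1 = 0" "A$3$2 = 0" "A$3$4 = 0" "A$4$1 = 0" "A$4$2 = 0" "A$4$3 = 0"
    "A$3$3 = A$4$4" "A$2$2 = A$4$4"
    using 0[of f2 f3] 0[of f1 f3] 0[of f1 f2] 0[of e2 e3] 0[of e2 f1] 0[of e3 f1]
      0[of e1 e3] 0[of e1 f2] 0[of e3 f2] 0[of e1 e2] 0[of e1 f3] 0[of e2 f3]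
      0[of e1 f1] 0[of e2 f2]
    by (simp_all add: sl_der_def bil_inner_der add_eq_0_iff)
  moreover from this have "A$1$1 = A$4$4"
    using tr by (simp add: trace_def sum_4 add_eq_0_iff add.assoc)
  ultimately have "A = mat (A$4$4)" by (simp add: mat_def vec_eq_iff forall_4)
  thus "A \<in> scalar_matrices" unfolding scalar_matrices_def by blast
next
  assume "A \<in> scalar_matrices"
  thus "sl_der A = (\<lambda>x. 0)" by (auto simp: scalar_matrices_def mat_def sl_der_def)
qed

lemma sl_der_add: "sl_der (A + B) x = sl_der A x + sl_der B x"
  by (simp add: sl_der_def scale_left_distrib add_ac)

lemma sl_der_scale: "sl_der (mat_scale c A) x = c \<cdot> sl_der A x"
  by (simp add: sl_der_def scale_right_distrib flip: distrib_left)

section \<open>The isomorphism with the projective special linear algebra\<close>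

lemma induces_unique:
  assumes d: "derivation d" "induces d A" and d': "derivation d'" "induces d' A"
  shows "d = d'"
proof -
  define h where "h x = d x + d' x" for x
  have h: "derivation h" unfolding h_def [abs_def] by (intro derivation_add d d')
  have w: "h (wedge p r) \<doteq> 0" for p r
  proof -
    let ?w = "wedge (A *v p) r + wedge p (A *v r)"
    obtain c c' where "d (wedge p r) = ?w + c \<cdot> e" "d' (wedge p r) = ?w + c' \<cdot> e"
      using d(2) d'(2) unfolding induces_def unit_cong_def by metis
    hence "h (wedge p r) = (c + c') \<cdot> e"
      unfolding h_def by (simp add: scale_left_distrib add_ac)
    thus ?thesis unfolding unit_cong_zero_iff by blast
  qed
  have fr: "wedge (axis 1 1) (axis 2 1) = e1" "wedge (axis 1 1) (axis 3 1) = e2"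
    "wedge (axis 1 1) (axis 4 1) = e3" "wedge (axis 3 1) (axis 4 1) = f1"
    "wedge (axis 2 1) (axis 4 1) = f2" "wedge (axis 2 1) (axis 3 1) = f3"
    by (simp_all add: wedge_def axis_def)
  have "h x = 0" for x
  proof (rule derivation_eq_zero[OF h])
    show "h x \<doteq> 0" if "\<langle>x, e\<rangle> = 0" for x
      using derivation_scalar_on_frame[OF h, of 0 x] that
        w[of "axis 1 1" "axis 2 1"] w[of "axis 1 1" "axis 3 1"] w[of "axis 1 1" "axis 4 1"]
        w[of "axis 3 1" "axis 4 1"] w[of "axis 2 1" "axis 4 1"] w[of "axis 2 1" "axis 3 1"]
      by (simp add: fr)
  qed
  thus ?thesis by (auto simp: h_def fun_eq_iff add_eq_0_iff)
qed

lemma derivation_bracket: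
  assumes "derivation d" "derivation d'"
  shows "derivation (\<lambda>x. d (d' x) - d' (d x))"
  using assms by (simp add: derivation_iff scale_right_distrib add_ac)

lemma sl_der_bracket:
  assumes "trace A = 0" "trace B = 0"
  shows "sl_der (A ** B - B ** A) = (\<lambda>x. sl_der A (sl_der B x) - sl_der B (sl_der A x))"
proof (rule induces_unique)
  have "trace (A ** B - B ** A) = 0"
    using trace_mul_sym[of A B] by (simp add: trace_sub)
  thus "induces (sl_der (A ** B - B ** A)) (A ** B - B ** A)" by (rule induces_sl_der)
qed (intro derivation_sl_der derivation_bracket induces_bracket induces_sl_der assms)+

text \<open>
  The inverse of the map that \<open>sl_der\<close> induces on cosets. Taking the whole fibre avoids a choice of
  representatives.
\<close>

definition psl_class :: "('c \<Rightarrow> 'c) \<Rightarrow> ('k^4^4) set" where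
  "psl_class d = {A. trace A = 0 \<and> sl_der A = d}"

lemma psl_class_sl_der:
  assumes A: "trace A = 0"
  shows "psl_class (sl_der A) = lie_coset sl scalar_matrices A"
proof (intro set_eqI iffI)
  fix B
  have diff: "sl_der (B - A) x = sl_der B x + sl_der A x" for x
    by (simp add: sl_der_def scale_left_distrib add_ac)
  show "B \<in> lie_coset sl scalar_matrices A" if "B \<in> psl_class (sl_der A)"
    using that A sl_der_eq_zero_iff[of "B - A"]
    by (auto simp: psl_class_def mem_coset_sl diff fun_eq_iff trace_sub)
  assume "B \<in> lie_coset sl scalar_matrices A"
  hence S: "B - A \<in> scalar_matrices" by (simp add: mem_coset_sl)
  hence tr: "trace (B - A) = 0"
    using scalar_matrices_subset_sl[OF char2] by (auto simp: sl_def)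
  with S have "sl_der (B - A) = (\<lambda>x. 0)" using sl_der_eq_zero_iff by blast
  hence "sl_der B = sl_der A" by (auto simp: diff fun_eq_iff add_eq_0_iff)
  moreover have "trace B = 0" using tr A by (simp add: trace_sub)
  ultimately show "B \<in> psl_class (sl_der A)" by (simp add: psl_class_def)
qed

lemma Der_isomorphic_psl4: "lie_isomorphic (Der sc mu) (psl4 :: ('k, ('k^4^4) set) lie)"
proof -
  let ?C = "lie_coset sl scalar_matrices :: 'k^4^4 \<Rightarrow> _"
  have D: "lcarrier (Der sc mu) = {d. derivation d}" by (simp add: Der_def derivation_def)
  have P: "lcarrier (psl4 :: ('k, ('k^4^4) set) lie) = ?C ` {A. trace A = 0}"
    by (simp add: psl4_def lie_quotient_def sl_def)
  have lift: "\<exists>A. trace A = 0 \<and> d = sl_der A \<and> psl_class d = ?C A" if "derivation d" for d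
    using derivation_is_sl_der[OF that] psl_class_sl_der by metis
  have inj: "inj_on psl_class {d. derivation d}"
  proof (rule inj_onI)
    fix d d' assume d: "d \<in> {d. derivation d}" and eq: "psl_class d = psl_class d'"
    then obtain A where "A \<in> psl_class d"
      using derivation_is_sl_der unfolding psl_class_def by blast
    with eq have "A \<in> psl_class d" "A \<in> psl_class d'" by auto
    thus "d = d'" unfolding psl_class_def by auto
  qed
  have surj: "psl_class ` {d. derivation d} = ?C ` {A. trace A = 0}"
  proof (intro set_eqI iffI)
    show "X \<in> ?C ` {A. trace A = 0}" if "X \<in> psl_class ` {d. derivation d}" for X
      using that lift by blast
    show "X \<in> psl_class ` {d. derivation d}" if "X \<in> ?C ` {A. trace A = 0}" for X
      using that derivation_sl_der psl_class_sl_der by blast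
  qed
  have add: "psl_class (\<lambda>x. d x + d' x) = ladd psl4 (psl_class d) (psl_class d')"
    and bracket: "psl_class (\<lambda>x. d (d' x) - d' (d x)) = lbracket psl4 (psl_class d) (psl_class d')"
    if der: "derivation d" "derivation d'" for d d'
  proof -
    obtain A where A: "trace A = 0" "d = sl_der A" "psl_class d = ?C A" using lift der by blast
    obtain B where B: "trace B = 0" "d' = sl_der B" "psl_class d' = ?C B" using lift der by blast
    have tr_add: "trace (A + B) = 0" by (simp add: A(1) B(1) trace_add)
    have sum_eq: "(\<lambda>x. d x + d' x) = sl_der (A + B)" by (simp add: A(2) B(2) sl_der_add fun_eq_iff)
    show "psl_class (\<lambda>x. d x + d' x) = ladd psl4 (psl_class d) (psl_class d')"
      by (simp only: sum_eq psl_class_sl_der[OF tr_add] A(3) B(3) psl4_ops)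
    have tr_comm: "trace (A ** B - B ** A) = 0"
      using trace_mul_sym[of A B] by (simp add: trace_sub)
    have comm_eq: "(\<lambda>x. d (d' x) - d' (d x)) = sl_der (A ** B - B ** A)"
      by (simp only: A(2) B(2) sl_der_bracket[OF A(1) B(1)])
    show "psl_class (\<lambda>x. d (d' x) - d' (d x)) = lbracket psl4 (psl_class d) (psl_class d')"
      by (simp only: comm_eq psl_class_sl_der[OF tr_comm] A(3) B(3) psl4_ops)
  qed
  have scale: "psl_class (\<lambda>x. c \<cdot> d x) = lscale psl4 c (psl_class d)" if der: "derivation d" for c d
  proof -
    obtain A where A: "trace A = 0" "d = sl_der A" "psl_class d = ?C A" using lift der by blast
    have tr: "trace (mat_scale c A) = 0"
      using arg_cong[OF A(1), of "(*) c"] by (simp add: trace_def sum_distrib_left)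
    have eq: "(\<lambda>x. c \<cdot> d x) = sl_der (mat_scale c A)" by (simp add: A(2) sl_der_scale fun_eq_iff)
    show ?thesis by (simp only: eq psl_class_sl_der[OF tr] A(3) psl4_ops)
  qed
  have "psl_class \<in> lie_iso (Der sc mu) (psl4 :: ('k, ('k^4^4) set) lie)"
    unfolding lie_iso_def mem_Collect_eq D P bij_betw_def
  proof (intro conjI ballI allI)
    show "inj_on psl_class {d. derivation d}" by (rule inj)
    show "psl_class ` {d. derivation d} = ?C ` {A. trace A = 0}" by (rule surj)
  qed (simp_all only: Der_def lie.simps mem_Collect_eq add scale bracket)
  thus ?thesis unfolding lie_isomorphic_def by blast
qed

end

theorem theorem15:
  fixes sc :: "'k::field \<Rightarrow> 'c::ab_group_add \<Rightarrow> 'c"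
    and mu :: "'c \<Rightarrow> 'c \<Rightarrow> 'c"
    and q :: "'c \<Rightarrow> 'k"
  assumes "CHAR('k) = 2"
    and "cayley_algebra sc mu q"
  shows "lie_isomorphic (Der sc mu) (psl4 :: ('k, ('k^4^4) set) lie)"
proof -
  interpret cayley_algebra sc mu q by fact
  obtain e where "\<And>x. mu e x = x" "\<And>x. mu x e = x" using unital by blast
  then interpret cayley_char2 sc mu q e
    using assms(1) by unfold_locales auto
  obtain e1 e2 e3 f1 f2 f3 u where "cayley_frame sc mu q e e1 e2 e3 f1 f2 f3 u"
    using cayley_frame_exists by blast
  thus ?thesis by (rule cayley_frame.Der_isomorphic_psl4)
qed

end
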